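(* Let $I\subset\mathbb{R}$ be a nonempty open interval and let $\psi:I\to E^3$ be a unit speed analytic curve whose curvature $\kappa$ is not identically zero. Let $\tau$ be its torsion and $\{T,N,B\}$ its modified orthogonal frame, and let $D_T$ denote differentiation along $\psi$ with respect to arc length. Then $\psi$ is a general helix if and only if $$D_TD_TD_TT=\mu N+\frac{3\kappa'}{\kappa}D_TN$$ holds (at all points where $\kappa\neq 0$), where $$\mu=\frac{\kappa''}{\kappa}-\kappa^2-\tau^2-3\left(\frac{\kappa'}{\kappa}\right)^2 .$$
   Context: $E^3$ is Euclidean 3-space with its standard inner product $\langle\cdot,\cdot\rangle$ and vector product $\times$; primes denote derivatives with respect to the arc length $s$. For a unit speed curve $\psi$, the modified orthogonal frame is $T=\psi'$, $N=T'=\psi''$, $B=T\times N$; in terms of the Frenet frame $\{\mathbf t,\mathbf n,\mathbf b\}$, at points where $\kappa\ne0$, $T=\mathbf t$, $N=\kappa\mathbf n$, $B=\kappa\mathbf b$. The curvature is $\kappa=\|\psi''\|$ and the torsion is $\tau=\det(\psi',\psi'',\psi''')/\kappa^2$ (zeros of $\kappa$ are removable singularities of $\tau$). A general helix is a curve whose unit tangent $T$ makes a constant angle with a fixed direction, i.e. there is a fixed unit vector $u$ with $\langle T,u\rangle$ constant. *)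

theory Defs
  imports "HOL-Analysis.Analysis"
begin

text \<open>
  A curve is a function on all of \<open>real\<close>; only its values on an open interval \<open>I\<close> matter, since every
  derivative below is taken at a point of \<open>I\<close> and depends only on the germ there.
\<close>

definition real_analytic_on :: "(real \<Rightarrow> 'a::real_normed_vector) \<Rightarrow> real set \<Rightarrow> bool"
    (infixl "real'_analytic'_on" 50) where
  "f real_analytic_on S \<longleftrightarrow>
     (\<forall>x\<in>S. \<exists>r>0. \<exists>a. \<forall>y\<in>ball x r. (\<lambda>n. (y - x) ^ n *\<^sub>R a n) sums f y)"

definition D_along :: "(real \<Rightarrow> 'a::real_normed_vector) \<Rightarrow> real \<Rightarrow> 'a" where
  "D_along X s = vector_derivative X (at s)"

definition unit_speed_on :: "real set \<Rightarrow> (real \<Rightarrow> real ^ 3) \<Rightarrow> bool" where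
  "unit_speed_on I \<psi> \<longleftrightarrow> (\<forall>s\<in>I. \<psi> differentiable at s \<and> norm (D_along \<psi> s) = 1)"

definition frame_T :: "(real \<Rightarrow> real ^ 3) \<Rightarrow> real \<Rightarrow> real ^ 3" where
  "frame_T \<psi> = D_along \<psi>"

definition frame_N :: "(real \<Rightarrow> real ^ 3) \<Rightarrow> real \<Rightarrow> real ^ 3" where
  "frame_N \<psi> = D_along (frame_T \<psi>)"

definition frame_B :: "(real \<Rightarrow> real ^ 3) \<Rightarrow> real \<Rightarrow> real ^ 3" where
  "frame_B \<psi> s = cross3 (frame_T \<psi> s) (frame_N \<psi> s)"

definition curvature :: "(real \<Rightarrow> real ^ 3) \<Rightarrow> real \<Rightarrow> real" where
  "curvature \<psi> s = norm (D_along (D_along \<psi>) s)"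

definition torsion_quotient :: "(real \<Rightarrow> real ^ 3) \<Rightarrow> real \<Rightarrow> real" where
  "torsion_quotient \<psi> s =
     det (vector [D_along \<psi> s, D_along (D_along \<psi>) s, D_along (D_along (D_along \<psi>)) s]
            :: real ^ 3 ^ 3)
     / (curvature \<psi> s)\<^sup>2"

text \<open>At zeros of the curvature, which are removable singularities, the torsion is the limit.\<close>

definition torsion :: "(real \<Rightarrow> real ^ 3) \<Rightarrow> real \<Rightarrow> real" where
  "torsion \<psi> s =
     (if curvature \<psi> s \<noteq> 0 then torsion_quotient \<psi> s else Lim (at s) (torsion_quotient \<psi>))"

definition general_helix_on :: "real set \<Rightarrow> (real \<Rightarrow> real ^ 3) \<Rightarrow> bool" where
  "general_helix_on I \<psi> \<longleftrightarrow> (\<exists>u. norm u = 1 \<and> (\<exists>c. \<forall>s\<in>I. frame_T \<psi> s \<bullet> u = c))"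

end

theory Submission
  imports Defs "HOL-Complex_Analysis.Cauchy_Integral_Formula"
begin

text \<open>
  At points with \<open>\<kappa> \<noteq> 0\<close> the \<open>T\<close> and \<open>N\<close> components of the equation hold for every unit speed curve,
  and the \<open>B\<close> component says that \<open>N\<close>, \<open>N'\<close>, \<open>N''\<close> are coplanar (equivalently, \<open>\<tau>/\<kappa>\<close> is locally
  constant). If \<open>\<langle>T, u\<rangle>\<close> is constant, then \<open>N\<close>, \<open>N'\<close>, \<open>N''\<close> are all orthogonal to \<open>u\<close>. Conversely,
  coplanarity makes the vector \<open>(\<tau>/\<kappa>) t + b\<close> locally constant; it is orthogonal to \<open>N\<close> near one
  point, hence on all of \<open>I\<close> by analyticity, even across the zeros of \<open>\<kappa>\<close>.
\<close>

section \<open>Real analytic maps\<close>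

lemma real_analytic_on_inner:
  assumes "f real_analytic_on S"
  shows "(\<lambda>x. f x \<bullet> u) real_analytic_on S"
  unfolding real_analytic_on_def
proof
  fix x assume "x \<in> S"
  then obtain r a where "r > 0" and a: "\<forall>y\<in>ball x r. (\<lambda>n. (y - x) ^ n *\<^sub>R a n) sums f y"
    using assms unfolding real_analytic_on_def by blast
  have "(\<lambda>n. (y - x) ^ n *\<^sub>R (a n \<bullet> u)) sums (f y \<bullet> u)" if "y \<in> ball x r" for y
    using bounded_linear.sums[OF bounded_linear_inner_left] a that by fastforce
  then show "\<exists>r>0. \<exists>a. \<forall>y\<in>ball x r. (\<lambda>n. (y - x) ^ n *\<^sub>R a n) sums (f y \<bullet> u)"
    using \<open>r > 0\<close> by (intro exI[of _ r] conjI exI[of _ "\<lambda>n. a n \<bullet> u"]) auto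
qed

section \<open>Termwise differentiation of vector-valued power series\<close>

lemma sums_componentwise_iff:
  fixes f :: "nat \<Rightarrow> 'a::euclidean_space"
  shows "f sums l \<longleftrightarrow> (\<forall>i\<in>Basis. (\<lambda>n. f n \<bullet> i) sums (l \<bullet> i))"
  unfolding sums_def by (subst tendsto_componentwise_iff) (simp add: inner_sum_left)

text \<open>The derivative is needed at every \<open>y\<close> in the ball, not only at the centre:
  only then is it again the sum of a power series about \<open>x\<close>. The vector case applies
  this to each coordinate.\<close>

lemma power_series_has_real_derivative:
  fixes f :: "real \<Rightarrow> real"
  assumes f: "\<And>y. y \<in> ball x r \<Longrightarrow> (\<lambda>n. (y - x) ^ n * a n) sums f y"
    and y: "y \<in> ball x r"
  obtains D where "(f has_real_derivative D) (at y)"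
    and "(\<lambda>n. (y - x) ^ n * (real (Suc n) * a (Suc n))) sums D"
proof -
  define g where "g = (\<lambda>z. \<Sum>n. a n * z ^ n)"
  have sm: "summable (\<lambda>n. a n * z ^ n)" if "norm z < r" for z
    using f[of "x + z"] that by (simp add: dist_norm sums_iff mult.commute)
  have yr: "norm (y - x) < r"
    using y by (simp add: dist_norm norm_minus_commute)
  have g: "(g has_real_derivative (\<Sum>n. diffs a n * (y - x) ^ n)) (at (y - x))"
    unfolding g_def using termdiffs_strong'[of r a "y - x"] sm yr by blast
  have "((\<lambda>z. g (z - x)) has_real_derivative (\<Sum>n. diffs a n * (y - x) ^ n)) (at y)"
    using DERIV_shift[of g "\<Sum>n. diffs a n * (y - x) ^ n" y "- x"] g by simp
  moreover have "g (z - x) = f z" if "z \<in> ball x r" for z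
    using f[OF that] by (simp add: g_def sums_iff mult.commute)
  ultimately have "(f has_real_derivative (\<Sum>n. diffs a n * (y - x) ^ n)) (at y)"
    using y has_field_derivative_transform_within_open[OF _ open_ball] by blast
  moreover have "summable (\<lambda>n. diffs a n * (y - x) ^ n)"
    by (rule termdiff_converges[of _ r]) (use sm yr in auto)
  then have "(\<lambda>n. (y - x) ^ n * (real (Suc n) * a (Suc n))) sums (\<Sum>n. diffs a n * (y - x) ^ n)"
    using summable_sums by (fastforce simp: diffs_def mult.commute)
  ultimately show thesis by (rule that)
qed

lemma
  fixes f :: "real \<Rightarrow> 'a::euclidean_space"
  assumes "f real_analytic_on S"
  shows real_analytic_on_has_vector_derivative:
      "s \<in> S \<Longrightarrow> (f has_vector_derivative D_along f s) (at s)"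
    and real_analytic_on_D_along: "D_along f real_analytic_on S"
proof -
  \<comment> \<open>Both conclusions come from one claim on a whole ball, which may leave
    \<open>S\<close>: analyticity of \<open>D_along f\<close> at \<open>x\<close> requires the
    differentiated series to represent \<open>D_along f\<close> at all nearby points.\<close>
  have *: "\<exists>r>0. \<exists>a. \<forall>y\<in>ball x r. (f has_vector_derivative D_along f y) (at y) \<and>
      (\<lambda>n. (y - x) ^ n *\<^sub>R a n) sums D_along f y" if x: "x \<in> S" for x
  proof -
    obtain r a where "r > 0" and a: "\<forall>y\<in>ball x r. (\<lambda>n. (y - x) ^ n *\<^sub>R a n) sums f y"
      using assms x unfolding real_analytic_on_def by blast
    have "(f has_vector_derivative D_along f y) (at y) \<and>
        (\<lambda>n. (y - x) ^ n *\<^sub>R (real (Suc n) *\<^sub>R a (Suc n))) sums D_along f y" if y: "y \<in> ball x r" for y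
    proof -
      have "\<exists>D. ((\<lambda>z. f z \<bullet> i) has_real_derivative D) (at y) \<and>
          (\<lambda>n. (y - x) ^ n * (real (Suc n) * (a (Suc n) \<bullet> i))) sums D" if "i \<in> Basis" for i
      proof (rule power_series_has_real_derivative[of x r "\<lambda>n. a n \<bullet> i" "\<lambda>z. f z \<bullet> i", OF _ y])
        show "(\<lambda>n. (z - x) ^ n * (a n \<bullet> i)) sums (f z \<bullet> i)" if "z \<in> ball x r" for z
          using a[rule_format, OF that] \<open>i \<in> Basis\<close> by (simp add: sums_componentwise_iff[of _ "f z"])
      qed blast
      then obtain D where D: "\<And>i. i \<in> Basis \<Longrightarrow> ((\<lambda>z. f z \<bullet> i) has_real_derivative D i) (at y)"
          "\<And>i. i \<in> Basis \<Longrightarrow> (\<lambda>n. (y - x) ^ n * (real (Suc n) * (a (Suc n) \<bullet> i))) sums D i"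
        by metis
      define d where "d = (\<Sum>i\<in>Basis. D i *\<^sub>R i)"
      have d: "d \<bullet> i = D i" if "i \<in> Basis" for i
        using that by (simp add: d_def)
      have "(f has_vector_derivative d) (at y)"
        unfolding has_vector_derivative_def
        by (subst has_derivative_componentwise_within)
          (use D(1) d in \<open>simp add: has_real_derivative_iff_has_vector_derivative
            has_vector_derivative_def\<close>)
      moreover from this have "D_along f y = d"
        unfolding D_along_def by (rule vector_derivative_at)
      moreover have "(\<lambda>n. (y - x) ^ n *\<^sub>R (real (Suc n) *\<^sub>R a (Suc n))) sums d"
        using D(2) d by (simp add: sums_componentwise_iff[of _ d] mult.assoc)
      ultimately show ?thesis by simp
    qed
    then show ?thesis
      using \<open>r > 0\<close> by (intro exI[of _ r] conjI exI[of _ "\<lambda>n. real (Suc n) *\<^sub>R a (Suc n)"]) auto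
  qed
  show "(f has_vector_derivative D_along f s) (at s)" if "s \<in> S"
    using *[OF that] centre_in_ball by blast
  show "D_along f real_analytic_on S"
    unfolding real_analytic_on_def
  proof
    fix x assume "x \<in> S"
    from *[OF this] obtain r a where "r > 0"
        "\<forall>y\<in>ball x r. (f has_vector_derivative D_along f y) (at y) \<and>
          (\<lambda>n. (y - x) ^ n *\<^sub>R a n) sums D_along f y"
      by (elim exE conjE) (rule that)
    then show "\<exists>r>0. \<exists>a. \<forall>y\<in>ball x r. (\<lambda>n. (y - x) ^ n *\<^sub>R a n) sums D_along f y"
      by (intro exI[of _ r] conjI exI[of _ a]) auto
  qed
qed

section \<open>Zeros of real analytic functions and the identity theorem\<close>

lemma real_analytic_on_islimpt_zeros:
  fixes f :: "real \<Rightarrow> real"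
  assumes f: "f real_analytic_on S" and x: "x \<in> S" and lim: "x islimpt {z. f z = 0}"
  shows "\<exists>r>0. \<forall>y\<in>ball x r. f y = 0"
proof -
  obtain r a where "r > 0" and a: "\<And>y. y \<in> ball x r \<Longrightarrow> (\<lambda>n. (y - x) ^ n *\<^sub>R a n) sums f y"
    using f x unfolding real_analytic_on_def by blast
  have sm: "(\<lambda>n. a n * (y - x) ^ n) sums f y" if "norm (y - x) < r" for y
    using a[of y] that by (simp add: dist_norm norm_minus_commute mult.commute)
  have "continuous (at x) f"
    using real_analytic_on_has_vector_derivative[OF f x]
    by (rule has_vector_derivative_continuous)
  moreover have "\<exists>\<^sub>F y in at x. f y = 0"
    using lim by (auto simp: islimpt_conv_frequently_at)
  ultimately have fx: "f x = 0"
  proof -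
    have "\<forall>\<^sub>F y in at x. f y \<noteq> 0" if "f x \<noteq> 0"
      using \<open>continuous (at x) f\<close> that by (auto simp: continuous_at intro: tendsto_imp_eventually_ne)
    then show ?thesis
      using \<open>\<exists>\<^sub>F y in at x. f y = 0\<close> by (auto simp: frequently_def)
  qed
  \<comment> \<open>The coefficient at 0 is \<open>f x\<close>, which vanishes by continuity. A
    nonzero coefficient of positive index would isolate \<open>x\<close> among the zeros, against
    the accumulation.\<close>
  have a0: "a m = 0" for m
  proof (cases "m = 0")
    case True
    have "(\<lambda>n. a n * 0 ^ n) sums f x" using sm[of x] \<open>r > 0\<close> by simp
    then show ?thesis using fx True by (simp add: sums_unique2)
  next
    case False
    show ?thesis
    proof (rule ccontr)
      assume "a m \<noteq> 0"
      then obtain s where "0 < s" and s: "\<And>z. z \<in> cball x s - {x} \<Longrightarrow> f z \<noteq> 0"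
        using powser_0_nonzero[OF \<open>r > 0\<close> sm fx] False by blast
      then show False
        using lim[unfolded islimpt_approachable, rule_format, of s]
        by (force simp: dist_commute)
    qed
  qed
  have "f y = 0" if "y \<in> ball x r" for y
    using a[OF that] by (simp add: a0 sums_iff)
  then show ?thesis using \<open>r > 0\<close> by blast
qed

lemma real_analytic_on_identity:
  fixes f :: "real \<Rightarrow> real"
  assumes f: "f real_analytic_on S" and "connected S"
    and x: "x \<in> S" and lim: "x islimpt {z. f z = 0}" and y: "y \<in> S"
  shows "f y = 0"
proof -
  \<comment> \<open>Describing \<open>Z\<close> by accumulation of zeros makes it closed in
    \<open>S\<close> at once; since accumulating zeros force \<open>f\<close> to vanish on a ball,
    \<open>Z\<close> is open in \<open>S\<close> as well.\<close>
  define Z where "Z = S \<inter> {z. z islimpt {z. f z = 0}}"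
  have nbhd: "\<exists>r>0. \<forall>y\<in>ball z r. f y = 0" if "z \<in> Z" for z
    using real_analytic_on_islimpt_zeros[OF f] that unfolding Z_def by blast
  have "openin (top_of_set S) Z"
    unfolding openin_contains_ball
  proof safe
    fix z assume "z \<in> Z"
    then obtain r where "r > 0" and r: "\<forall>y\<in>ball z r. f y = 0" using nbhd by blast
    have "ball z r \<inter> S \<subseteq> Z"
    proof safe
      fix w assume "w \<in> ball z r" "w \<in> S"
      moreover have "w islimpt ball z r"
        using \<open>w \<in> ball z r\<close> by (simp add: open_imp_islimpt)
      ultimately show "w \<in> Z"
        unfolding Z_def using r by (auto intro: islimpt_subset)
    qed
    then show "\<exists>e>0. ball z e \<inter> S \<subseteq> Z" using \<open>r > 0\<close> by blast
  qed (auto simp: Z_def)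
  moreover have "closedin (top_of_set S) Z"
    unfolding Z_def by (intro closedin_closed_Int closed_limpts)
  moreover have "x \<in> Z" using x lim by (simp add: Z_def)
  ultimately have "Z = S" using \<open>connected S\<close> by (auto simp: connected_clopen)
  then show ?thesis using y nbhd centre_in_ball by blast
qed

section \<open>Vector algebra\<close>

lemma bounded_bilinear_cross3: "bounded_bilinear cross3"
  using bilinear_cross bilinear_conv_bounded_bilinear by blast

lemmas has_vector_derivative_cross3 =
  bounded_bilinear.has_vector_derivative[OF bounded_bilinear_cross3]

lemma has_real_derivative_inner:
  assumes "(f has_vector_derivative f') (at s)" "(g has_vector_derivative g') (at s)"
  shows "((\<lambda>s. f s \<bullet> g s) has_real_derivative (f s \<bullet> g' + f' \<bullet> g s)) (at s)"
  using bounded_bilinear.has_vector_derivative[OF bounded_bilinear_inner assms]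
  by (simp add: has_real_derivative_iff_has_vector_derivative)

lemma has_real_derivative_norm:
  assumes f: "(f has_vector_derivative f') (at s)" and "f s \<noteq> 0"
  shows "((\<lambda>s. norm (f s)) has_real_derivative (f s \<bullet> f') / norm (f s)) (at s)"
proof -
  have "((\<lambda>s. sqrt (f s \<bullet> f s)) has_real_derivative
      inverse (sqrt (f s \<bullet> f s)) / 2 * (f s \<bullet> f' + f' \<bullet> f s)) (at s)"
    by (rule DERIV_chain'[OF has_real_derivative_inner[OF f f] DERIV_real_sqrt]) (simp add: \<open>f s \<noteq> 0\<close>)
  then show ?thesis
    by (simp add: norm_eq_sqrt_inner[symmetric] inner_commute[of f'] divide_inverse_commute[of "f s \<bullet> f'"])
qed

text \<open>Cramer's rule: the identity w [x,y,z] = x [w,y,z] + y [x,w,z] + z [x,y,w] for triple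
  products, paired with \<open>w\<close>. It serves with \<open>w\<close> the unit tangent or a
  fixed axis.\<close>

lemma triple_product_expansion:
  "(w \<bullet> w) * (x \<bullet> cross3 y z) =
    (w \<bullet> x) * (w \<bullet> cross3 y z) + (w \<bullet> y) * (x \<bullet> cross3 w z) + (w \<bullet> z) * (x \<bullet> cross3 y w)"
  by (simp add: cross3_simps)

text \<open>The right-hand side is the Gram determinant of \<open>x\<close>, \<open>y\<close>,
  \<open>z\<close>, expanded along its first row.\<close>

lemma triple_product_gram:
  "(x \<bullet> cross3 y z)\<^sup>2 = (x \<bullet> x) * ((y \<bullet> y) * (z \<bullet> z) - (y \<bullet> z)\<^sup>2)
    - (x \<bullet> y) * ((x \<bullet> y) * (z \<bullet> z) - (y \<bullet> z) * (x \<bullet> z))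
    + (x \<bullet> z) * ((x \<bullet> y) * (y \<bullet> z) - (y \<bullet> y) * (x \<bullet> z))"
  by (simp add: cross3_simps power2_eq_square)

text \<open>Orthogonality to \<open>T\<close> and \<open>N\<close> makes \<open>v\<close> parallel
  to \<open>cross3 T N\<close>, which is nonzero; the last condition then leaves only 0.\<close>

lemma eq_0_if_inner_orthogonal_frame:
  assumes "T \<bullet> T = 1" "T \<bullet> N = 0" "N \<noteq> 0"
    and v: "v \<bullet> T = 0" "v \<bullet> N = 0" "v \<bullet> cross3 T N = 0"
  shows "v = 0"
proof -
  have "cross3 v (cross3 T N) = 0"
    using v by (simp add: Lagrange)
  moreover have "cross3 T N \<noteq> 0"
    using norm_and_cross_eq_0[of T N] assms(1-3) by auto
  ultimately show ?thesis
    using v(3) norm_and_cross_eq_0 by blast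
qed

text \<open>Pointwise form of the equation: \<open>A\<close> and \<open>C\<close> stand for N' and
  N'', and \<open>k1\<close>, \<open>k2\<close>, \<open>t\<close> for \<kappa>', \<kappa>'', \<tau>.
  The difference \<open>v\<close> of the two sides is always orthogonal to \<open>T\<close> and
  \<open>N\<close>, and its product with \<open>cross3 T N\<close> is the triple product up to the
  factor \<open>k\<^sup>2\<close>.\<close>

lemma helix_equation_iff_coplanar:
  fixes T N A C :: "real ^ 3"
  assumes TT: "T \<bullet> T = 1" and TN: "T \<bullet> N = 0" and TA: "T \<bullet> A = - (N \<bullet> N)"
    and TC: "T \<bullet> C = - 3 * (N \<bullet> A)" and "N \<noteq> 0"
    and k: "k = norm N" and k1: "k1 = (N \<bullet> A) / k"
    and k2: "k2 = (A \<bullet> A + N \<bullet> C) / k - (N \<bullet> A)\<^sup>2 / k ^ 3"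
    and t: "t = (T \<bullet> cross3 N A) / k\<^sup>2"
  shows "C = (k2 / k - k\<^sup>2 - t\<^sup>2 - 3 * (k1 / k)\<^sup>2) *\<^sub>R N + (3 * k1 / k) *\<^sub>R A
    \<longleftrightarrow> N \<bullet> cross3 A C = 0"
proof -
  define m where "m = k2 / k - k\<^sup>2 - t\<^sup>2 - 3 * (k1 / k)\<^sup>2"
  define c where "c = 3 * k1 / k"
  define v where "v = C - (m *\<^sub>R N + c *\<^sub>R A)"
  have "k > 0" using \<open>N \<noteq> 0\<close> by (simp add: k)
  have NN: "N \<bullet> N = k\<^sup>2" by (simp add: k power2_norm_eq_inner)
  have c: "c * k\<^sup>2 = 3 * (N \<bullet> A)"
    using \<open>k > 0\<close> by (simp add: c_def k1 power2_eq_square)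
  have tk: "t * k\<^sup>2 = T \<bullet> cross3 N A" and k1k: "k1 * k = N \<bullet> A"
    and k2k: "k2 * k ^ 3 = k\<^sup>2 * (A \<bullet> A + N \<bullet> C) - (N \<bullet> A)\<^sup>2"
    using \<open>k > 0\<close> by (simp_all add: t k1 k2 field_simps power2_eq_square power3_eq_cube)
  \<comment> \<open>The Gram determinant eliminates the squared torsion, which occurs in
    \<open>m\<close>, in favour of inner products.\<close>
  have gram: "(t * k\<^sup>2)\<^sup>2 = k\<^sup>2 * (A \<bullet> A) - (N \<bullet> A)\<^sup>2 - (k\<^sup>2) ^ 3"
    unfolding tk triple_product_gram[of T N A] TT TN TA NN by algebra
  have m: "m * k ^ 4 = k2 * k ^ 3 - (k\<^sup>2) ^ 3 - (t * k\<^sup>2)\<^sup>2 - 3 * (k1 * k)\<^sup>2"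
    using \<open>k > 0\<close> by (simp add: m_def field_simps eval_nat_numeral)
  have "v \<bullet> T = 0"
    using c by (simp add: v_def inner_diff_right inner_add_right inner_commute[of _ T] TN TA TC NN)
  moreover have "v \<bullet> N = 0"
  proof -
    \<comment> \<open>The terms \<open>A \<bullet> A\<close> and \<open>(k\<^sup>2) ^ 3\<close> from
      \<kappa>'', \<kappa> and \<tau> cancel; this is what fixes the form of \<mu>.\<close>
    have "m * k ^ 4 = k\<^sup>2 * (N \<bullet> C) - 3 * (N \<bullet> A)\<^sup>2"
      using m unfolding gram k1k k2k by algebra
    moreover have "k\<^sup>2 * (v \<bullet> N) = k\<^sup>2 * (N \<bullet> C) - m * k ^ 4 - (c * k\<^sup>2) * (N \<bullet> A)"
    proof -
      have "v \<bullet> N = N \<bullet> C - m * k\<^sup>2 - c * (N \<bullet> A)"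
        by (simp add: v_def inner_diff_left inner_add_left NN inner_commute[of C N] inner_commute[of A N])
      then show ?thesis by algebra
    qed
    ultimately have "k\<^sup>2 * (v \<bullet> N) = 0" unfolding c by algebra
    then show ?thesis using \<open>k > 0\<close> by simp
  qed
  moreover have "k\<^sup>2 * (v \<bullet> cross3 T N) = N \<bullet> cross3 A C"
  proof -
    have *: "N \<bullet> cross3 A C = - (N \<bullet> N) * (N \<bullet> cross3 T C) - 3 * (N \<bullet> A) * (N \<bullet> cross3 A T)"
      using triple_product_expansion[of T N A C] by (simp add: TT TN TA TC)
    have **: "N \<bullet> cross3 T C = - (C \<bullet> cross3 T N)" "N \<bullet> cross3 A T = A \<bullet> cross3 T N"
      by (simp_all add: cross3_simps)
    have "v \<bullet> cross3 T N = C \<bullet> cross3 T N - c * (A \<bullet> cross3 T N)"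
      by (simp add: v_def inner_diff_left inner_add_left dot_cross_self)
    with * ** NN c show ?thesis by algebra
  qed
  ultimately have "v = 0 \<longleftrightarrow> N \<bullet> cross3 A C = 0"
    using eq_0_if_inner_orthogonal_frame[OF TT TN \<open>N \<noteq> 0\<close>] \<open>k > 0\<close> by fastforce
  then show ?thesis by (simp add: v_def m_def c_def)
qed

text \<open>This is \<open>(\<tau>/\<kappa>) t + b\<close> in the Frenet frame, for \<open>A = N'\<close>.\<close>

definition helix_axis :: "real ^ 3 \<Rightarrow> real ^ 3 \<Rightarrow> real ^ 3 \<Rightarrow> real ^ 3" where
  "helix_axis T N A =
    ((T \<bullet> cross3 N A) / norm N ^ 3) *\<^sub>R T + (1 / norm N) *\<^sub>R cross3 T N"

text \<open>The component along \<open>cross3 T N\<close> cannot vanish, whatever \<open>A\<close>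
  is.\<close>

lemma helix_axis_nonzero:
  assumes "T \<bullet> N = 0" "T \<noteq> 0" "N \<noteq> 0"
  shows "helix_axis T N A \<noteq> 0"
proof
  assume "helix_axis T N A = 0"
  then have "helix_axis T N A \<bullet> cross3 T N = 0" by simp
  then have "cross3 T N = 0"
    using \<open>N \<noteq> 0\<close> by (simp add: helix_axis_def inner_add_left dot_cross_self)
  then show False using assms norm_and_cross_eq_0[of T N] by auto
qed

lemma helix_axis_orthogonal:
  assumes "T \<bullet> N = 0"
  shows "N \<bullet> helix_axis T N A = 0"
  using assms by (simp add: helix_axis_def inner_add_right dot_cross_self inner_commute)

text \<open>The derivative is (\<tau>/\<kappa>)' t + (\<tau>/\<kappa>) t' + b'. The last two terms
  cancel by the Frenet equations, since t' = \<kappa> n and b' = -\<tau> n; the first vanishes by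
  coplanarity.\<close>

lemma helix_axis_has_vector_derivative_0:
  fixes T N A :: "real \<Rightarrow> real ^ 3"
  assumes T: "(T has_vector_derivative N s) (at s)"
    and N: "(N has_vector_derivative A s) (at s)"
    and A: "(A has_vector_derivative C) (at s)"
    and TT: "T s \<bullet> T s = 1" and TN: "T s \<bullet> N s = 0" and TA: "T s \<bullet> A s = - (N s \<bullet> N s)"
    and TC: "T s \<bullet> C = - 3 * (N s \<bullet> A s)" and N0: "N s \<noteq> 0"
    and coplanar: "N s \<bullet> cross3 (A s) C = 0"
  shows "((\<lambda>s. helix_axis (T s) (N s) (A s)) has_vector_derivative 0) (at s)"
proof -
  define k where "k = norm (N s)"
  define p where "p = T s \<bullet> cross3 (N s) (A s)"
  define q where "q = T s \<bullet> cross3 (N s) C"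
  have "k > 0" using N0 by (simp add: k_def)
  have NN: "N s \<bullet> N s = k\<^sup>2" by (simp add: k_def power2_norm_eq_inner)
  have dk: "((\<lambda>s. norm (N s)) has_real_derivative (N s \<bullet> A s) / k) (at s)"
    unfolding k_def by (rule has_real_derivative_norm[OF N N0])
  \<comment> \<open>Differentiating the first or second factor repeats a vector, so only the third
    contributes.\<close>
  have dp: "((\<lambda>s. T s \<bullet> cross3 (N s) (A s)) has_real_derivative q) (at s)"
    using has_real_derivative_inner[OF T has_vector_derivative_cross3[OF N A]]
    by (simp add: q_def dot_cross_self)
  have dc: "((\<lambda>s. cross3 (T s) (N s)) has_vector_derivative cross3 (T s) (A s)) (at s)"
    using has_vector_derivative_cross3[OF T N] by simp
  have d1: "((\<lambda>s. (T s \<bullet> cross3 (N s) (A s)) / norm (N s) ^ 3) has_real_derivative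
      (q / k ^ 3 - 3 * p * (N s \<bullet> A s) / k ^ 5)) (at s)"
    using \<open>k > 0\<close> by (auto intro!: derivative_eq_intros dp dk simp: k_def[symmetric] p_def[symmetric] field_simps power_numeral_reduce)
  have d2: "((\<lambda>s. 1 / norm (N s)) has_real_derivative (- (N s \<bullet> A s) / k ^ 3)) (at s)"
    using \<open>k > 0\<close> by (auto intro!: derivative_eq_intros dk simp: k_def[symmetric] field_simps power_numeral_reduce)
  \<comment> \<open>This says that the derivative of \<open>p / k ^ 3\<close>, that is of
    \<tau>/\<kappa>, is zero.\<close>
  have pq: "q * k\<^sup>2 = 3 * p * (N s \<bullet> A s)"
  proof -
    have "N s \<bullet> cross3 (A s) C = - (N s \<bullet> N s) * (N s \<bullet> cross3 (T s) C) - 3 * (N s \<bullet> A s) * (N s \<bullet> cross3 (A s) (T s))"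
      using triple_product_expansion[of "T s" "N s" "A s" C] by (simp add: TT TN TA TC)
    moreover have "N s \<bullet> cross3 (T s) C = - q" "N s \<bullet> cross3 (A s) (T s) = p"
      by (simp_all add: q_def p_def cross3_simps)
    ultimately show ?thesis using coplanar by (simp add: NN algebra_simps)
  qed
  \<comment> \<open>\<open>v\<close> is (\<tau>/\<kappa>) t' + b'; it is shown to vanish by testing
    against the frame.\<close>
  define v where "v = (p / k ^ 3) *\<^sub>R N s + (1 / k) *\<^sub>R cross3 (T s) (A s)
    - ((N s \<bullet> A s) / k ^ 3) *\<^sub>R cross3 (T s) (N s)"
  have "v \<bullet> T s = 0"
    by (simp add: v_def inner_diff_right inner_add_right dot_cross_self TN inner_commute[of _ "T s"])
  moreover have "v \<bullet> N s = 0"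
  proof -
    have "cross3 (T s) (A s) \<bullet> N s = - p" by (simp add: p_def cross3_simps)
    then show ?thesis
      using \<open>k > 0\<close> by (simp add: v_def inner_diff_left inner_add_left dot_cross_self NN power_numeral_reduce field_simps)
  qed
  moreover have "v \<bullet> cross3 (T s) (N s) = 0"
  proof -
    have "cross3 (T s) (A s) \<bullet> cross3 (T s) (N s) = N s \<bullet> A s"
      "cross3 (T s) (N s) \<bullet> cross3 (T s) (N s) = k\<^sup>2"
      by (simp_all add: dot_cross TT TN NN inner_commute[of "A s" "N s"])
    then show ?thesis
      using \<open>k > 0\<close> by (simp add: v_def inner_diff_left inner_add_left dot_cross_self power_numeral_reduce field_simps)
  qed
  ultimately have v: "v = 0"
    using eq_0_if_inner_orthogonal_frame[OF TT TN N0] by blast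
  have "q / k ^ 3 - 3 * p * (N s \<bullet> A s) / k ^ 5 = 0"
    using pq \<open>k > 0\<close> by (simp add: field_simps power_numeral_reduce)
  then have "((\<lambda>s. helix_axis (T s) (N s) (A s)) has_vector_derivative v) (at s)"
    unfolding helix_axis_def
    using has_vector_derivative_add[OF has_vector_derivative_scaleR[OF d1 T] has_vector_derivative_scaleR[OF d2 dc]]
    by (simp add: v_def k_def[symmetric] p_def[symmetric] algebra_simps)
  then show ?thesis by (simp add: v)
qed

section \<open>General helices\<close>

lemma constant_on_open_has_derivative_0:
  fixes f :: "real \<Rightarrow> real"
  assumes "(f has_real_derivative D) (at s)" "open S" "s \<in> S" "\<And>x. x \<in> S \<Longrightarrow> f x = c"
  shows "D = 0"
proof -
  have "((\<lambda>_. c) has_real_derivative D) (at s)"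
    using assms(1-3) by (rule has_field_derivative_transform_within_open) (simp add: assms(4))
  then show ?thesis by (rule DERIV_unique[OF _ DERIV_const])
qed

lemma
  fixes N A :: "real \<Rightarrow> real ^ 3"
  assumes "open S" and N: "\<And>s. s \<in> S \<Longrightarrow> (N has_vector_derivative A s) (at s)"
    and A: "\<And>s. s \<in> S \<Longrightarrow> (A has_vector_derivative C s) (at s)"
    and N0: "\<And>s. s \<in> S \<Longrightarrow> N s \<noteq> 0" and "s \<in> S"
  shows deriv_norm: "deriv (\<lambda>s. norm (N s)) s = (N s \<bullet> A s) / norm (N s)"
    and deriv_deriv_norm: "deriv (deriv (\<lambda>s. norm (N s))) s =
      (A s \<bullet> A s + N s \<bullet> C s) / norm (N s) - (N s \<bullet> A s)\<^sup>2 / norm (N s) ^ 3"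
proof -
  \<comment> \<open>Stated on all of \<open>S\<close>, so that the formula can itself be
    differentiated at \<open>s\<close>.\<close>
  have d: "deriv (\<lambda>s. norm (N s)) s = (N s \<bullet> A s) / norm (N s)" if "s \<in> S" for s
    using has_real_derivative_norm[OF N N0] that by (blast intro: DERIV_imp_deriv)
  then show "deriv (\<lambda>s. norm (N s)) s = (N s \<bullet> A s) / norm (N s)" using \<open>s \<in> S\<close> .
  have "((\<lambda>s. (N s \<bullet> A s) / norm (N s)) has_real_derivative
      ((N s \<bullet> C s + A s \<bullet> A s) * norm (N s) - (N s \<bullet> A s) * ((N s \<bullet> A s) / norm (N s)))
        / (norm (N s) * norm (N s))) (at s)"
    using \<open>s \<in> S\<close> N0
    by (intro DERIV_divide has_real_derivative_inner has_real_derivative_norm N A) auto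
  then have "(deriv (\<lambda>s. norm (N s)) has_real_derivative
      ((N s \<bullet> C s + A s \<bullet> A s) * norm (N s) - (N s \<bullet> A s) * ((N s \<bullet> A s) / norm (N s)))
        / (norm (N s) * norm (N s))) (at s)"
    using \<open>open S\<close> \<open>s \<in> S\<close> by (rule has_field_derivative_transform_within_open) (simp add: d)
  then show "deriv (deriv (\<lambda>s. norm (N s))) s =
      (A s \<bullet> A s + N s \<bullet> C s) / norm (N s) - (N s \<bullet> A s)\<^sup>2 / norm (N s) ^ 3"
    using N0[OF \<open>s \<in> S\<close>]
    by (simp add: DERIV_imp_deriv field_simps power2_eq_square power3_eq_cube)
qed

theorem theorem3p3:
  fixes I :: "real set" and \<psi> :: "real \<Rightarrow> real ^ 3"
  assumes "open I" and "is_interval I" and "I \<noteq> {}"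
    and "\<psi> real_analytic_on I"
    and "unit_speed_on I \<psi>"
    and "\<exists>s\<in>I. curvature \<psi> s \<noteq> 0"
  shows "general_helix_on I \<psi> \<longleftrightarrow>
    (let T = frame_T \<psi>; N = frame_N \<psi>; \<kappa> = curvature \<psi>; \<tau> = torsion \<psi>;
         \<mu> = (\<lambda>s. deriv (deriv \<kappa>) s / \<kappa> s - (\<kappa> s)\<^sup>2 - (\<tau> s)\<^sup>2 - 3 * (deriv \<kappa> s / \<kappa> s)\<^sup>2)
     in \<forall>s\<in>I. \<kappa> s \<noteq> 0 \<longrightarrow>
          D_along (D_along (D_along T)) s
            = \<mu> s *\<^sub>R N s + (3 * deriv \<kappa> s / \<kappa> s) *\<^sub>R D_along N s)"
proof -
  define T where "T = D_along \<psi>"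
  define N where "N = D_along T"
  define A where "A = D_along N"
  define C where "C = D_along A"
  have T_an: "T real_analytic_on I" and N_an: "N real_analytic_on I" and A_an: "A real_analytic_on I"
    using assms(4) by (simp_all add: T_def N_def A_def real_analytic_on_D_along)
  have T: "(T has_vector_derivative N s) (at s)" and N: "(N has_vector_derivative A s) (at s)"
    and A: "(A has_vector_derivative C s) (at s)" if "s \<in> I" for s
    using real_analytic_on_has_vector_derivative[OF T_an that]
      real_analytic_on_has_vector_derivative[OF N_an that]
      real_analytic_on_has_vector_derivative[OF A_an that]
    by (simp_all flip: N_def A_def C_def)
  note const = constant_on_open_has_derivative_0[OF _ assms(1)]
  have TT: "T s \<bullet> T s = 1" if "s \<in> I" for s
    using assms(5) that by (simp add: unit_speed_on_def T_def norm_eq_1)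
  have TN: "T s \<bullet> N s = 0" if "s \<in> I" for s
    using const[OF has_real_derivative_inner[OF T T] that TT] that by (simp add: inner_commute)
  have TA: "T s \<bullet> A s = - (N s \<bullet> N s)" if "s \<in> I" for s
    using const[OF has_real_derivative_inner[OF T N] that TN] that by simp
  have TC: "T s \<bullet> C s = - 3 * (N s \<bullet> A s)" if "s \<in> I" for s
  proof -
    \<comment> \<open>This differentiates T \<bullet> A + N \<bullet> N = 0, the third step in the
      chain that starts from T \<bullet> T = 1.\<close>
    have "(T s \<bullet> C s + N s \<bullet> A s) + (N s \<bullet> A s + A s \<bullet> N s) = 0"
      using const[OF DERIV_add[OF has_real_derivative_inner[OF T A] has_real_derivative_inner[OF N N]] that,
          of 0] TA that by simp
    then show ?thesis by (simp add: inner_commute)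
  qed
  define J where "J = {s \<in> I. N s \<noteq> 0}"
  have JI: "J \<subseteq> I" by (auto simp: J_def)
  have "continuous_on I N"
    using N by (meson continuous_at_imp_continuous_on has_vector_derivative_continuous)
  then have "open J"
    unfolding J_def using continuous_open_preimage[OF _ assms(1), of N "- {0}"]
    by (simp add: vimage_def Int_def open_Compl)
  have \<kappa>: "curvature \<psi> = (\<lambda>s. norm (N s))"
    by (simp add: curvature_def[abs_def] N_def T_def)
  \<comment> \<open>On \<open>J\<close> the torsion is the plain quotient; its limit value at zeros
    of the curvature never enters.\<close>
  have \<tau>: "torsion \<psi> s = (T s \<bullet> cross3 (N s) (A s)) / (norm (N s))\<^sup>2" if "s \<in> J" for s
    using that unfolding torsion_def torsion_quotient_def \<kappa>
    by (simp add: J_def dot_cross_det T_def N_def A_def)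
  have eq: "C s = (deriv (deriv (curvature \<psi>)) s / curvature \<psi> s - (curvature \<psi> s)\<^sup>2
        - (torsion \<psi> s)\<^sup>2 - 3 * (deriv (curvature \<psi>) s / curvature \<psi> s)\<^sup>2) *\<^sub>R N s
        + (3 * deriv (curvature \<psi>) s / curvature \<psi> s) *\<^sub>R A s
      \<longleftrightarrow> N s \<bullet> cross3 (A s) (C s) = 0" if "s \<in> J" for s
  proof -
    have "s \<in> I" "N s \<noteq> 0" using that by (auto simp: J_def)
    have NJ: "(N has_vector_derivative A x) (at x)" and AJ: "(A has_vector_derivative C x) (at x)"
      and N0: "N x \<noteq> 0" if "x \<in> J" for x
      using that N A by (simp_all add: J_def)
    show ?thesis
      using \<open>s \<in> I\<close> \<open>N s \<noteq> 0\<close> \<tau>[OF that] unfolding \<kappa>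
      by (intro helix_equation_iff_coplanar[OF TT TN TA TC] refl
          deriv_norm[OF \<open>open J\<close> NJ AJ N0 that] deriv_deriv_norm[OF \<open>open J\<close> NJ AJ N0 that])
  qed
  have "general_helix_on I \<psi> \<longleftrightarrow> (\<forall>s\<in>J. N s \<bullet> cross3 (A s) (C s) = 0)"
  proof
    assume "general_helix_on I \<psi>"
    then obtain u c where u: "norm u = 1" and Tu: "\<And>s. s \<in> I \<Longrightarrow> T s \<bullet> u = c"
      by (auto simp: general_helix_on_def frame_T_def T_def)
    note du = has_real_derivative_inner[OF _ has_vector_derivative_const[of u]]
    have Nu: "N s \<bullet> u = 0" if "s \<in> I" for s
      using const[OF du[OF T] that Tu] that by simp
    have Au: "A s \<bullet> u = 0" if "s \<in> I" for s
      using const[OF du[OF N] that Nu] that by simp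
    have Cu: "C s \<bullet> u = 0" if "s \<in> I" for s
      using const[OF du[OF A] that Au] that by simp
    show "\<forall>s\<in>J. N s \<bullet> cross3 (A s) (C s) = 0"
    proof
      fix s assume "s \<in> J"
      then have "u \<bullet> N s = 0" "u \<bullet> A s = 0" "u \<bullet> C s = 0" "u \<bullet> u = 1"
        using JI Nu Au Cu u by (auto simp: inner_commute norm_eq_1)
      then show "N s \<bullet> cross3 (A s) (C s) = 0"
        \<comment> \<open>All three coefficients on the right vanish, while
          \<open>u \<bullet> u = 1\<close>.\<close>
        using triple_product_expansion[of u "N s" "A s" "C s"] by simp
    qed
  next
    assume coplanar: "\<forall>s\<in>J. N s \<bullet> cross3 (A s) (C s) = 0"
    obtain s0 where "s0 \<in> J" using assms(6) by (auto simp: J_def \<kappa>)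
    then obtain e where "e > 0" and e: "ball s0 e \<subseteq> J"
      using \<open>open J\<close> open_contains_ball by blast
    \<comment> \<open>The candidate axis is frozen at one point of nonzero curvature; it is
      normalised only at the end.\<close>
    define h where "h = helix_axis (T s0) (N s0) (A s0)"
    have "((\<lambda>s. helix_axis (T s) (N s) (A s)) has_vector_derivative 0) (at s)" if "s \<in> ball s0 e" for s
    proof -
      have "s \<in> J" "s \<in> I" "N s \<noteq> 0" using that e JI by (auto simp: J_def)
      then show ?thesis
        using coplanar by (intro helix_axis_has_vector_derivative_0[OF T N A TT TN TA TC]) auto
    qed
    then obtain h' where "\<And>s. s \<in> ball s0 e \<Longrightarrow> helix_axis (T s) (N s) (A s) = h'"
      using has_vector_derivative_zero_constant[OF convex_ball]
        has_vector_derivative_at_within by (metis (no_types, lifting))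
    then have h: "helix_axis (T s) (N s) (A s) = h" if "s \<in> ball s0 e" for s
      using that \<open>e > 0\<close> by (simp add: h_def)
    have "N s \<bullet> h = 0" if "s \<in> ball s0 e" for s
    proof -
      have "s \<in> I" using that e JI by blast
      then show ?thesis using helix_axis_orthogonal[OF TN] h[OF that] by metis
    qed
    moreover have "s0 islimpt ball s0 e"
      using \<open>e > 0\<close> by (simp add: open_imp_islimpt)
    ultimately have "s0 islimpt {s. N s \<bullet> h = 0}"
      by (auto intro: islimpt_subset)
    \<comment> \<open>The passage across zeros of the curvature: the axis field is known to be
      constant only near \<open>s0\<close>, but N \<bullet> h is analytic on the connected set
      \<open>I\<close>.\<close>
    then have Nh: "N s \<bullet> h = 0" if "s \<in> I" for s
      using real_analytic_on_identity[OF real_analytic_on_inner[OF N_an]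
          is_interval_connected[OF assms(2)]] \<open>s0 \<in> J\<close> JI that by blast
    \<comment> \<open>The derivative of T \<bullet> h is N \<bullet> h, so the angle with
      \<open>h\<close> is constant on the whole interval.\<close>
    have "((\<lambda>s. T s \<bullet> h) has_vector_derivative 0) (at s within I)" if "s \<in> I" for s
      using has_real_derivative_inner[OF T has_vector_derivative_const, OF that, of h] Nh[OF that]
      by (simp add: has_real_derivative_iff_has_vector_derivative has_vector_derivative_at_within)
    then obtain c where c: "\<And>s. s \<in> I \<Longrightarrow> T s \<bullet> h = c"
      using has_vector_derivative_zero_constant[OF is_interval_convex[OF assms(2)]] by blast
    have "h \<noteq> 0"
      unfolding h_def using \<open>s0 \<in> J\<close> TT[of s0] TN[of s0]
      by (intro helix_axis_nonzero) (auto simp: J_def)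
    then have "norm (h /\<^sub>R norm h) = 1" "\<forall>s\<in>I. frame_T \<psi> s \<bullet> (h /\<^sub>R norm h) = c / norm h"
      using c by (simp_all add: frame_T_def divide_inverse flip: T_def)
    then show "general_helix_on I \<psi>"
      unfolding general_helix_on_def by blast
  qed
  also have "\<dots> \<longleftrightarrow> (\<forall>s\<in>I. curvature \<psi> s \<noteq> 0 \<longrightarrow>
      C s = (deriv (deriv (curvature \<psi>)) s / curvature \<psi> s - (curvature \<psi> s)\<^sup>2
        - (torsion \<psi> s)\<^sup>2 - 3 * (deriv (curvature \<psi>) s / curvature \<psi> s)\<^sup>2) *\<^sub>R N s
        + (3 * deriv (curvature \<psi>) s / curvature \<psi> s) *\<^sub>R A s)"
    using eq by (auto simp: J_def \<kappa>)
  finally show ?thesis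
    by (simp add: Let_def frame_T_def frame_N_def C_def A_def N_def T_def)
qed

end
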